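(* Suppose all access costs $c_j$, $j\in N_x$, are integers, and let $M=\min\{\sum_{j\in N_x}c_j,\ \beta\}$. If there is a constant $\delta<1$ such that $\rho_j\le\delta$ for all $j\in N_x$, and $A_{\mathrm{Knap}}$ is a polynomial-time $(1+\epsilon)$-approximation algorithm for Knapsack ($\epsilon\ge 0$) running in time $O(f(n_x,\epsilon))$, then algorithm $\mathrm{DS}_{\mathrm{PP}}$ (described in the context) is a pseudo-polynomial algorithm that finds an $O\!\left(\beta^{\frac{\epsilon}{1+\epsilon}}\right)$-approximate solution to the Data Store Selection problem in time $O(f(n_x,\epsilon)\cdot M)$. That is, the returned set $D$ satisfies $\phi(D)\le C\,\beta^{\frac{\epsilon}{1+\epsilon}}\min_{D'\subseteq N_x}\phi(D')$ for a constant $C$ that may depend on $\delta$ only.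
   Context: $N_x$ is a finite set of $n_x$ data stores; each $j\in N_x$ has an access cost $c_j\ge 1$ and a misindication ratio $\rho_j\in[0,1]$; $\beta\ge 1$ is the miss penalty. For $D\subseteq N_x$ the expected cost is $\phi(D)=\sum_{j\in D}c_j+\beta\prod_{j\in D}\rho_j$ (empty sum $0$, empty product $1$). The Data Store Selection (DSS) problem is to find $D\subseteq N_x$ minimizing $\phi(D)$. Knapsack: in the $(B,U,\pi,\gamma)$-Knapsack problem one is given a budget $B$ and a set $U$ of items, item $j$ having profit $\pi_j$ and cost $\gamma_j$; the goal is a set $S\subseteq U$ with $\sum_{j\in S}\gamma_j\le B$ maximizing $\sum_{j\in S}\pi_j$. A $(1+\epsilon)$-approximation algorithm returns a feasible set whose profit is at least $\frac1{1+\epsilon}$ times the optimum. $A_{\mathrm{Knap}}(B,U,\pi,\gamma)$ denotes the set output by a Knapsack algorithm $A_{\mathrm{Knap}}$. Algorithm $\mathrm{DS}_{\mathrm{PP}}$: set $w_j=-\log\rho_j$ for $j\in N_x$ (logarithms are base 2, $-\log 0=+\infty$); for every integer $B\in\{0,1,\dots,M\}$ (i.e. $0\le B\le M$) compute $D_B=A_{\mathrm{Knap}}(B,N_x,w,c)$; return the $D_B$ minimizing $\phi(D_B)$. *)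

theory Defs
  imports Complex_Main "HOL-Library.Extended_Real" "HOL-Library.Log_Nat"
    "HOL-Computational_Algebra.Polynomial"
begin

text \<open>
  A run of an algorithm is a result together with the number of elementary steps spent on it
  (unit-cost arithmetic on reals, including \<open>log\<close>). Programs are composed with
  \<open>bind_timed\<close>, which adds up the steps; \<open>tick\<close> charges one elementary step.
\<close>

datatype 'a timed = Timed (outcome: 'a) (steps: nat)

definition return_timed :: "'a \<Rightarrow> 'a timed" where
  "return_timed x = Timed x 0"

definition tick :: "'a \<Rightarrow> 'a timed" where
  "tick x = Timed x 1"

definition bind_timed :: "'a timed \<Rightarrow> ('a \<Rightarrow> 'b timed) \<Rightarrow> 'b timed" (infixl "\<then>" 54) where
  "m \<then> k = Timed (outcome (k (outcome m))) (steps m + steps (k (outcome m)))"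

text \<open>
  Finite sets of items are handed to algorithms, and returned by them, as distinct lists.
  Profits are extended reals because a misindication ratio \<open>0\<close> yields profit \<open>\<infinity>\<close>.
  Budget and costs are integers; hence algorithms are only required to work in the integral case.
\<close>

type_synonym 'a knapsack_algorithm =
  "real \<Rightarrow> 'a list \<Rightarrow> ('a \<Rightarrow> ereal) \<Rightarrow> ('a \<Rightarrow> real) \<Rightarrow> 'a list timed"

definition knapsack_instance ::
    "real \<Rightarrow> 'a list \<Rightarrow> ('a \<Rightarrow> ereal) \<Rightarrow> ('a \<Rightarrow> real) \<Rightarrow> bool" where
  "knapsack_instance B U \<pi> \<gamma> \<longleftrightarrow> distinct U \<and> B \<in> \<int> \<and> 0 \<le> B \<and>
     (\<forall>j\<in>set U. 0 \<le> \<pi> j \<and> \<gamma> j \<in> \<int> \<and> 0 \<le> \<gamma> j)"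

definition knapsack_feasible :: "real \<Rightarrow> 'a set \<Rightarrow> ('a \<Rightarrow> real) \<Rightarrow> 'a set set" where
  "knapsack_feasible B U \<gamma> = {S. S \<subseteq> U \<and> (\<Sum>j\<in>S. \<gamma> j) \<le> B}"

definition knapsack_opt :: "real \<Rightarrow> 'a set \<Rightarrow> ('a \<Rightarrow> ereal) \<Rightarrow> ('a \<Rightarrow> real) \<Rightarrow> ereal" where
  "knapsack_opt B U \<pi> \<gamma> = Max ((\<lambda>S. \<Sum>j\<in>S. \<pi> j) ` knapsack_feasible B U \<gamma>)"

definition knapsack_approximation :: "real \<Rightarrow> 'a knapsack_algorithm \<Rightarrow> bool" where
  "knapsack_approximation \<epsilon> A \<longleftrightarrow>
     (\<forall>B U \<pi> \<gamma>. knapsack_instance B U \<pi> \<gamma> \<longrightarrow>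
        (let S = outcome (A B U \<pi> \<gamma>) in
           distinct S \<and> set S \<in> knapsack_feasible B (set U) \<gamma> \<and>
           (\<Sum>j\<in>set S. \<pi> j) \<ge> ereal (1 / (1 + \<epsilon>)) * knapsack_opt B (set U) \<pi> \<gamma>))"

text \<open>
  The algorithm is a black box reporting its own number of steps. In addition, a run is charged
  one step per item, for reading the instance.
\<close>

definition run_knapsack :: "'a knapsack_algorithm \<Rightarrow> 'a knapsack_algorithm" where
  "run_knapsack A B U \<pi> \<gamma> = Timed U (length U) \<then> (\<lambda>U. A B U \<pi> \<gamma>)"

definition knapsack_time ::
    "'a knapsack_algorithm \<Rightarrow> real \<Rightarrow> 'a list \<Rightarrow> ('a \<Rightarrow> ereal) \<Rightarrow> ('a \<Rightarrow> real) \<Rightarrow> nat" where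
  "knapsack_time A B U \<pi> \<gamma> = steps (run_knapsack A B U \<pi> \<gamma>)"

text \<open>
  Integers count with their binary length (\<open>floorlog 2 m\<close> is the number of binary digits of
  \<open>m\<close>); real-valued profits count as one unit each.
\<close>

definition knapsack_size :: "real \<Rightarrow> 'a list \<Rightarrow> ('a \<Rightarrow> real) \<Rightarrow> nat" where
  "knapsack_size B U \<gamma> =
     length U + floorlog 2 (nat \<lfloor>B\<rfloor>) + (\<Sum>j\<in>set U. floorlog 2 (nat \<lfloor>\<gamma> j\<rfloor>))"

definition knapsack_polynomial_time :: "'a knapsack_algorithm \<Rightarrow> bool" where
  "knapsack_polynomial_time A \<longleftrightarrow>
     (\<exists>p :: nat poly. \<forall>B U \<pi> \<gamma>. knapsack_instance B U \<pi> \<gamma> \<longrightarrow>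
        knapsack_time A B U \<pi> \<gamma> \<le> poly p (knapsack_size B U \<gamma>))"

definition dss_instance ::
    "'a list \<Rightarrow> ('a \<Rightarrow> real) \<Rightarrow> ('a \<Rightarrow> real) \<Rightarrow> real \<Rightarrow> bool" where
  "dss_instance N c \<rho> \<beta> \<longleftrightarrow>
     distinct N \<and> (\<forall>j\<in>set N. 1 \<le> c j \<and> 0 \<le> \<rho> j \<and> \<rho> j \<le> 1) \<and> 1 \<le> \<beta>"

definition dss_bounded_integral_instance ::
    "real \<Rightarrow> 'a list \<Rightarrow> ('a \<Rightarrow> real) \<Rightarrow> ('a \<Rightarrow> real) \<Rightarrow> real \<Rightarrow> bool" where
  "dss_bounded_integral_instance \<delta> N c \<rho> \<beta> \<longleftrightarrow>
     dss_instance N c \<rho> \<beta> \<and> (\<forall>j\<in>set N. c j \<in> \<int>) \<and> (\<forall>j\<in>set N. \<rho> j \<le> \<delta>)"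

definition dss_cost :: "('a \<Rightarrow> real) \<Rightarrow> ('a \<Rightarrow> real) \<Rightarrow> real \<Rightarrow> 'a set \<Rightarrow> real" where
  "dss_cost c \<rho> \<beta> D = (\<Sum>j\<in>D. c j) + \<beta> * (\<Prod>j\<in>D. \<rho> j)"

definition dss_opt :: "'a set \<Rightarrow> ('a \<Rightarrow> real) \<Rightarrow> ('a \<Rightarrow> real) \<Rightarrow> real \<Rightarrow> real" where
  "dss_opt N c \<rho> \<beta> = Min (dss_cost c \<rho> \<beta> ` Pow N)"

definition budget_bound :: "'a set \<Rightarrow> ('a \<Rightarrow> real) \<Rightarrow> real \<Rightarrow> real" where
  "budget_bound N c \<beta> = min (\<Sum>j\<in>N. c j) \<beta>"

text \<open>
  Pseudo-polynomial: polynomial in the number of stores and the magnitudes of the numbers in the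
  input. The misindication ratios are at most \<open>1\<close> and contribute no magnitude.
\<close>

definition dss_unary_size :: "'a list \<Rightarrow> ('a \<Rightarrow> real) \<Rightarrow> real \<Rightarrow> nat" where
  "dss_unary_size N c \<beta> = length N + (\<Sum>j\<in>set N. nat \<lceil>c j\<rceil>) + nat \<lceil>\<beta>\<rceil>"

type_synonym 'a dss_algorithm =
  "'a list \<Rightarrow> ('a \<Rightarrow> real) \<Rightarrow> ('a \<Rightarrow> real) \<Rightarrow> real \<Rightarrow> 'a list timed"

definition dss_pseudo_polynomial_on ::
    "('a list \<Rightarrow> ('a \<Rightarrow> real) \<Rightarrow> ('a \<Rightarrow> real) \<Rightarrow> real \<Rightarrow> bool) \<Rightarrow> 'a dss_algorithm \<Rightarrow> bool" where
  "dss_pseudo_polynomial_on P alg \<longleftrightarrow>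
     (\<exists>p :: nat poly. \<forall>N c \<rho> \<beta>. P N c \<rho> \<beta> \<longrightarrow>
        steps (alg N c \<rho> \<beta>) \<le> poly p (dss_unary_size N c \<beta>))"

definition neg_log :: "real \<Rightarrow> ereal" where
  "neg_log x = (if x = 0 then \<infinity> else ereal (- log 2 x))"

fun sum_timed :: "('a \<Rightarrow> real) \<Rightarrow> 'a list \<Rightarrow> real timed" where
  "sum_timed g [] = return_timed 0"
| "sum_timed g (j # js) = sum_timed g js \<then> (\<lambda>s. tick (g j + s))"

fun prod_timed :: "('a \<Rightarrow> real) \<Rightarrow> 'a list \<Rightarrow> real timed" where
  "prod_timed g [] = return_timed 1"
| "prod_timed g (j # js) = prod_timed g js \<then> (\<lambda>s. tick (g j * s))"

fun weights_timed :: "('a \<Rightarrow> real) \<Rightarrow> 'a list \<Rightarrow> ('a \<Rightarrow> ereal) timed" where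
  "weights_timed \<rho> [] = return_timed (\<lambda>_. 0)"
| "weights_timed \<rho> (j # js) = weights_timed \<rho> js \<then> (\<lambda>w. tick (w(j := neg_log (\<rho> j))))"

definition dss_cost_timed ::
    "('a \<Rightarrow> real) \<Rightarrow> ('a \<Rightarrow> real) \<Rightarrow> real \<Rightarrow> 'a list \<Rightarrow> real timed" where
  "dss_cost_timed c \<rho> \<beta> D =
     sum_timed c D \<then> (\<lambda>s. prod_timed \<rho> D \<then> (\<lambda>p. tick (\<beta> * p) \<then> (\<lambda>q. tick (s + q))))"

definition candidate_timed ::
    "'a knapsack_algorithm \<Rightarrow> 'a list \<Rightarrow> ('a \<Rightarrow> real) \<Rightarrow> ('a \<Rightarrow> real) \<Rightarrow> real \<Rightarrow> ('a \<Rightarrow> ereal) \<Rightarrow>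
     nat \<Rightarrow> ('a list \<times> real) timed" where
  "candidate_timed A N c \<rho> \<beta> w B =
     run_knapsack A (real B) N w c \<then> (\<lambda>D. dss_cost_timed c \<rho> \<beta> D \<then> (\<lambda>v. return_timed (D, v)))"

text \<open>
  The best candidate for the budgets \<open>0, \<dots>, B\<close> and its cost; ties are resolved in favour
  of the smaller budget. An iteration is charged a step for the counter and one for the comparison.
\<close>

fun best_timed ::
    "'a knapsack_algorithm \<Rightarrow> 'a list \<Rightarrow> ('a \<Rightarrow> real) \<Rightarrow> ('a \<Rightarrow> real) \<Rightarrow> real \<Rightarrow> ('a \<Rightarrow> ereal) \<Rightarrow>
     nat \<Rightarrow> ('a list \<times> real) timed" where
  "best_timed A N c \<rho> \<beta> w 0 = candidate_timed A N c \<rho> \<beta> w 0"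
| "best_timed A N c \<rho> \<beta> w (Suc B) =
     best_timed A N c \<rho> \<beta> w B \<then> (\<lambda>x.
     tick (Suc B) \<then> (\<lambda>B'.
     candidate_timed A N c \<rho> \<beta> w B' \<then> (\<lambda>y.
     tick (if snd y < snd x then y else x))))"

definition ds_pp :: "'a knapsack_algorithm \<Rightarrow> 'a dss_algorithm" where
  "ds_pp A N c \<rho> \<beta> =
     weights_timed \<rho> N \<then> (\<lambda>w.
     sum_timed c N \<then> (\<lambda>s.
     tick (min s \<beta>) \<then> (\<lambda>M.
     tick (nat \<lfloor>M\<rfloor>) \<then> (\<lambda>m.
     best_timed A N c \<rho> \<beta> w m \<then> (\<lambda>x.
     return_timed (fst x))))))"

end

theory Submission
  imports Defs
begin

text \<open>
  Let \<open>D*\<close> be an optimal selection and \<open>P\<close> the product of its misindication ratios. As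
  \<open>\<phi>(D*) \<le> \<phi>(\<emptyset>) = \<beta>\<close>, the integer \<open>c(D*)\<close> is at most \<open>M\<close>, so it is one of the
  budgets tried. The candidate for this budget costs at most
  \<open>c(D*) + \<beta> P\<^sup>a = c(D*) + \<beta>\<^bsup>1-a\<^esup> (\<beta> P)\<^sup>a\<close> with \<open>a = 1/(1+\<epsilon>)\<close>, since its log-profit is at least
  \<open>a\<close> times that of \<open>D*\<close>. Finally \<open>(\<beta> P)\<^sup>a \<le> \<phi>(D*)\<close> because \<open>\<phi>(D*) \<ge> \<beta> P\<close> and
  \<open>\<phi>(D*) \<ge> 1\<close>: either \<open>D*\<close> is empty and \<open>\<beta> P = \<beta> \<ge> 1\<close>, or \<open>c(D*) \<ge> 1\<close>.
  Hence \<open>C = 2\<close>.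
\<close>

section \<open>Cost and result of the basic timed programs\<close>

lemma steps_simps [simp]:
  "steps (return_timed x) = 0"
  "steps (tick x) = 1"
  "steps (m \<then> k) = steps m + steps (k (outcome m))"
  by (simp_all add: return_timed_def tick_def bind_timed_def)

lemma outcome_simps [simp]:
  "outcome (return_timed x) = x"
  "outcome (tick x) = x"
  "outcome (m \<then> k) = outcome (k (outcome m))"
  by (simp_all add: return_timed_def tick_def bind_timed_def)

lemma steps_sum_timed [simp]: "steps (sum_timed g xs) = length xs"
  by (induction xs) auto

lemma outcome_sum_timed: "distinct xs \<Longrightarrow> outcome (sum_timed g xs) = (\<Sum>j\<in>set xs. g j)"
  by (induction xs) auto

lemma steps_prod_timed [simp]: "steps (prod_timed g xs) = length xs"
  by (induction xs) auto

lemma outcome_prod_timed: "distinct xs \<Longrightarrow> outcome (prod_timed g xs) = (\<Prod>j\<in>set xs. g j)"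
  by (induction xs) auto

lemma steps_weights_timed [simp]: "steps (weights_timed \<rho> xs) = length xs"
  by (induction xs) auto

lemma outcome_weights_timed:
  "j \<in> set xs \<Longrightarrow> outcome (weights_timed \<rho> xs) j = neg_log (\<rho> j)"
  by (induction xs) auto

lemma steps_dss_cost_timed [simp]: "steps (dss_cost_timed c \<rho> \<beta> D) = 2 * length D + 2"
  by (simp add: dss_cost_timed_def)

lemma outcome_dss_cost_timed:
  "distinct D \<Longrightarrow> outcome (dss_cost_timed c \<rho> \<beta> D) = dss_cost c \<rho> \<beta> (set D)"
  by (simp add: dss_cost_timed_def dss_cost_def outcome_sum_timed outcome_prod_timed)

lemma outcome_run_knapsack [simp]: "outcome (run_knapsack A B U \<pi> \<gamma>) = outcome (A B U \<pi> \<gamma>)"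
  by (simp add: run_knapsack_def)

text \<open>The charge for reading the instance is what later lets overheads linear in the number of
  items be absorbed into the Knapsack time.\<close>

lemma length_le_knapsack_time: "length U \<le> knapsack_time A B U \<pi> \<gamma>"
  by (simp add: knapsack_time_def run_knapsack_def)

lemma fst_outcome_candidate_timed [simp]:
  "fst (outcome (candidate_timed A N c \<rho> \<beta> w B)) = outcome (A (real B) N w c)"
  by (simp add: candidate_timed_def)

lemma snd_outcome_candidate_timed:
  "distinct (outcome (A (real B) N w c)) \<Longrightarrow>
   snd (outcome (candidate_timed A N c \<rho> \<beta> w B)) = dss_cost c \<rho> \<beta> (set (outcome (A (real B) N w c)))"
  by (simp add: candidate_timed_def outcome_dss_cost_timed)

lemma steps_candidate_timed:
  "steps (candidate_timed A N c \<rho> \<beta> w B) =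
     knapsack_time A (real B) N w c + 2 * length (outcome (A (real B) N w c)) + 2"
  by (simp add: candidate_timed_def knapsack_time_def)

section \<open>Minimization over the budgets\<close>

lemma best_timed_is_candidate:
  "\<exists>B\<le>m. outcome (best_timed A N c \<rho> \<beta> w m) = outcome (candidate_timed A N c \<rho> \<beta> w B)"
proof (induction m)
  case (Suc m)
  then obtain B where "B \<le> m"
    "outcome (best_timed A N c \<rho> \<beta> w m) = outcome (candidate_timed A N c \<rho> \<beta> w B)"
    by blast
  then show ?case
    by (auto intro: exI[of _ B] exI[of _ "Suc m"])
qed auto

lemma best_timed_minimal:
  "B \<le> m \<Longrightarrow> snd (outcome (best_timed A N c \<rho> \<beta> w m))
     \<le> snd (outcome (candidate_timed A N c \<rho> \<beta> w B))"
proof (induction m)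
  case (Suc m)
  then show ?case by (cases "B = Suc m") fastforce+
qed auto

text \<open>The extra 2 pays for the counter and the comparison of an iteration; budget 0 incurs
  neither, so the bound has slack there.\<close>

lemma steps_best_timed_le:
  assumes "\<And>B. B \<le> m \<Longrightarrow> steps (candidate_timed A N c \<rho> \<beta> w B) \<le> T"
  shows "steps (best_timed A N c \<rho> \<beta> w m) \<le> (m + 1) * (T + 2)"
  using assms
proof (induction m)
  case 0
  from "0.prems"[of 0] show ?case by simp
next
  case (Suc m)
  have "steps (best_timed A N c \<rho> \<beta> w m) \<le> (m + 1) * (T + 2)"
    by (rule Suc.IH) (simp add: Suc.prems)
  with Suc.prems[of "Suc m"] show ?case by simp
qed

section \<open>Log-profits and the inequality behind the ratio\<close>

lemma neg_log_nonneg: "0 \<le> x \<Longrightarrow> x \<le> 1 \<Longrightarrow> 0 \<le> neg_log x"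
  by (auto simp: neg_log_def zero_ereal_def)

text \<open>Zero factors are no exception: \<open>neg_log\<close> never takes the value
  -\<infinity>, so a summand \<infinity> makes the sum \<infinity>.\<close>

lemma neg_log_mult:
  assumes "0 \<le> x" "0 \<le> y"
  shows "neg_log (x * y) = neg_log x + neg_log y"
  using assms by (auto simp: neg_log_def log_mult)

lemma neg_log_prod:
  assumes "finite D" "\<And>j. j \<in> D \<Longrightarrow> 0 \<le> \<rho> j"
  shows "neg_log (\<Prod>j\<in>D. \<rho> j) = (\<Sum>j\<in>D. neg_log (\<rho> j))"
  using assms
proof (induction D)
  case empty
  then show ?case by (simp add: neg_log_def zero_ereal_def)
next
  case (insert x D)
  then show ?case by (simp add: neg_log_mult prod_nonneg)
qed

text \<open>Turns a guarantee on log-profits back into one on products. For positive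
  \<open>Q\<close> the right side is finite; since \<open>a\<close> is positive, this rules out
  \<open>P = 0\<close>, and the logarithms can be undone.\<close>

lemma le_powr_if_neg_log_ge:
  assumes "0 < a" "0 \<le> P" "0 \<le> Q" "ereal a * neg_log P \<le> neg_log Q"
  shows "Q \<le> P powr a"
proof (cases "Q = 0")
  case False
  with \<open>0 \<le> Q\<close> have Q: "0 < Q" by simp
  have "P \<noteq> 0"
    using assms(1,4) False by (auto simp: neg_log_def)
  with \<open>0 \<le> P\<close> have P: "0 < P" by simp
  have "log 2 Q \<le> a * log 2 P"
    using assms(4) P Q by (simp add: neg_log_def)
  then have "log 2 Q \<le> log 2 (P powr a)"
    using P by (simp add: log_powr)
  then show ?thesis using P Q by simp
qed simp

text \<open>\<open>S\<close> is the access cost of the selection compared with, \<open>P\<close> its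
  product and \<open>Q\<close> that of the candidate. Both \<open>S\<close> and
  \<open>\<beta> * Q\<close> are at most \<open>\<beta> powr b * (S + \<beta> * P)\<close>, whence
  the factor 2.\<close>

lemma budget_powr_bound:
  fixes \<beta> :: real
  assumes \<beta>: "1 \<le> \<beta>" and "0 \<le> P" and "0 \<le> \<epsilon>" and S: "0 \<le> S" "1 \<le> S + \<beta> * P"
    and Q: "Q \<le> P powr (1 / (1 + \<epsilon>))"
  shows "S + \<beta> * Q \<le> 2 * \<beta> powr (\<epsilon> / (1 + \<epsilon>)) * (S + \<beta> * P)"
proof -
  define a b where "a = 1 / (1 + \<epsilon>)" and "b = \<epsilon> / (1 + \<epsilon>)"
  have ab: "a + b = 1" "0 \<le> a" "0 \<le> b"
    using \<open>0 \<le> \<epsilon>\<close> by (auto simp: a_def b_def add_divide_distrib[symmetric])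
  have "(\<beta> * P) powr a \<le> (S + \<beta> * P) powr a"
    using assms ab by (intro powr_mono2) auto
  \<comment> \<open>Raising the exponent from \<open>a\<close> to 1 is harmless because the base is
    at least 1.\<close>
  also have "\<dots> \<le> (S + \<beta> * P) powr 1"
    using ab S by (intro powr_mono) auto
  finally have root: "(\<beta> * P) powr a \<le> S + \<beta> * P"
    using S by simp
  have "\<beta> * Q \<le> \<beta> * P powr a"
    using Q \<beta> by (simp add: a_def)
  \<comment> \<open>Splitting the exponent 1 of \<beta> lets \<open>\<beta> powr a\<close> merge
    with \<open>P powr a\<close>.\<close>
  also have "\<dots> = \<beta> powr (b + a) * P powr a"
    using ab \<beta> by (simp add: add.commute)
  also have "\<dots> = \<beta> powr b * (\<beta> * P) powr a"
    using \<beta> \<open>0 \<le> P\<close> by (simp add: powr_add powr_mult)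
  also have "\<dots> \<le> \<beta> powr b * (S + \<beta> * P)"
    using root by (simp add: mult_left_mono)
  finally have "\<beta> * Q \<le> \<beta> powr b * (S + \<beta> * P)" .
  moreover have "S \<le> \<beta> powr b * (S + \<beta> * P)"
  proof -
    have "1 \<le> \<beta> powr b" using \<beta> ab by (simp add: ge_one_powr_ge_zero)
    then have "1 * (S + \<beta> * P) \<le> \<beta> powr b * (S + \<beta> * P)"
      using S by (intro mult_right_mono) auto
    moreover have "S \<le> 1 * (S + \<beta> * P)" using \<beta> \<open>0 \<le> P\<close> by simp
    ultimately show ?thesis by (rule order_trans[rotated])
  qed
  ultimately show ?thesis by (simp add: b_def)
qed

section \<open>Binary length against unary size\<close>

lemma floorlog_2_le: "floorlog 2 x \<le> x"
proof (cases "x = 0")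
  case False
  then have "2 ^ (floorlog 2 x - 1) \<le> x"
    using floorlog_bounds[of x 2] by simp
  with less_exp[of "floorlog 2 x - 1"] show ?thesis by linarith
qed (simp add: floorlog_def)

text \<open>Coefficients in the naturals are nonnegative, hence monotonicity.\<close>

lemma poly_nat_mono: "x \<le> y \<Longrightarrow> poly p x \<le> poly p y" for p :: "nat poly"
  by (induction p) (auto intro: add_mono mult_mono)

text \<open>The cap of the budgets at \<beta> matters here: the digits of \<open>B\<close> are
  charged to the summand \<open>nat \<lceil>\<beta>\<rceil>\<close>, those of each cost to its own
  magnitude.\<close>

lemma knapsack_size_le_dss_unary_size:
  assumes "real B \<le> \<beta>"
  shows "knapsack_size (real B) N c \<le> dss_unary_size N c \<beta>"
proof -
  have "floorlog 2 (nat \<lfloor>real B\<rfloor>) \<le> nat \<lceil>\<beta>\<rceil>"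
    using floorlog_2_le[of B] assms by (simp add: le_nat_iff) linarith
  moreover have "(\<Sum>j\<in>set N. floorlog 2 (nat \<lfloor>c j\<rfloor>)) \<le> (\<Sum>j\<in>set N. nat \<lceil>c j\<rceil>)"
    by (intro sum_mono order_trans[OF floorlog_2_le] nat_mono floor_le_ceiling)
  ultimately show ?thesis
    unfolding knapsack_size_def dss_unary_size_def by linarith
qed

section \<open>One run of the algorithm on a fixed instance\<close>

locale dss_run =
  fixes A :: "'a knapsack_algorithm" and N :: "'a list" and c \<rho> :: "'a \<Rightarrow> real" and \<beta> \<delta> \<epsilon> :: real
  assumes eps_nonneg: "0 \<le> \<epsilon>"
    and approx: "knapsack_approximation \<epsilon> A"
    and inst: "dss_bounded_integral_instance \<delta> N c \<rho> \<beta>"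
begin

definition w where "w = outcome (weights_timed \<rho> N)"

definition m where "m = nat \<lfloor>budget_bound (set N) c \<beta>\<rfloor>"

text \<open>The set \<open>D_B\<close> of the algorithm, as a list; it is defined for every natural
  \<open>B\<close>, also above \<open>m\<close>.\<close>

definition cand where "cand B = outcome (A (real B) N w c)"

lemma distinct_N: "distinct N"
  and cost_ge_1: "j \<in> set N \<Longrightarrow> 1 \<le> c j"
  and cost_Ints: "j \<in> set N \<Longrightarrow> c j \<in> \<int>"
  and ratio_nonneg: "j \<in> set N \<Longrightarrow> 0 \<le> \<rho> j"
  and ratio_le_1: "j \<in> set N \<Longrightarrow> \<rho> j \<le> 1"
  and penalty_ge_1: "1 \<le> \<beta>"
  using inst by (auto simp: dss_bounded_integral_instance_def dss_instance_def)

lemma cost_nonneg: "j \<in> set N \<Longrightarrow> 0 \<le> c j"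
  using cost_ge_1[of j] by simp

lemma w_eq: "j \<in> set N \<Longrightarrow> w j = neg_log (\<rho> j)"
  by (simp add: w_def outcome_weights_timed)

text \<open>The link between the two problems: maximizing the profit of a selection minimizes its
  product of misindication ratios.\<close>

lemma sum_w: "D \<subseteq> set N \<Longrightarrow> (\<Sum>j\<in>D. w j) = neg_log (\<Prod>j\<in>D. \<rho> j)"
  by (subst neg_log_prod)
    (auto simp: w_eq ratio_nonneg subset_iff intro: finite_subset[OF _ finite_set] sum.cong)

lemma knapsack_instance: "knapsack_instance (real B) N w c"
  unfolding knapsack_instance_def
  using distinct_N cost_Ints cost_nonneg ratio_nonneg ratio_le_1
  by (auto simp: w_eq neg_log_nonneg)

lemma distinct_cand: "distinct (cand B)"
  and cand_subset: "set (cand B) \<subseteq> set N"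
  and cand_budget: "(\<Sum>j\<in>set (cand B). c j) \<le> real B"
  and cand_profit: "ereal (1 / (1 + \<epsilon>)) * knapsack_opt (real B) (set N) w c
      \<le> (\<Sum>j\<in>set (cand B). w j)"
  using approx knapsack_instance[of B]
  by (auto simp: knapsack_approximation_def knapsack_feasible_def Let_def cand_def)

text \<open>Distinctness makes this a comparison of cardinalities; it bounds the time for evaluating
  the cost of a candidate.\<close>

lemma length_cand_le: "length (cand B) \<le> length N"
  using card_mono[OF finite_set cand_subset[of B]] distinct_cand distinct_N
  by (simp add: distinct_card)

section \<open>The largest budget and the approximation ratio\<close>

lemma budget_bound_nonneg: "0 \<le> budget_bound (set N) c \<beta>"
  using penalty_ge_1 cost_nonneg by (auto simp: budget_bound_def intro!: sum_nonneg)

lemma m_le: "real m \<le> budget_bound (set N) c \<beta>"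
  \<comment> \<open>Nonnegativity matters: \<open>nat\<close> would round a negative value up to
    0.\<close>
  using budget_bound_nonneg by (simp add: m_def)

text \<open>As the budget equals the access cost of \<open>D\<close>, the selection \<open>D\<close>
  competes in the Knapsack instance and the candidate spends no more on access; only the miss terms
  remain to be compared.\<close>

lemma cand_cost:
  assumes D: "D \<subseteq> set N" "(\<Sum>j\<in>D. c j) = real B"
  shows "dss_cost c \<rho> \<beta> (set (cand B))
    \<le> 2 * \<beta> powr (\<epsilon> / (1 + \<epsilon>)) * dss_cost c \<rho> \<beta> D"
proof -
  define P Q where "P = (\<Prod>j\<in>D. \<rho> j)" and "Q = (\<Prod>j\<in>set (cand B). \<rho> j)"
  have "finite D" using D(1) by (rule finite_subset) simp
  have P: "0 \<le> P" and Q: "0 \<le> Q"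
    unfolding P_def Q_def using D(1) cand_subset ratio_nonneg by (auto intro!: prod_nonneg)
  have "finite (knapsack_feasible (real B) (set N) c)"
    by (rule finite_subset[of _ "Pow (set N)"]) (auto simp: knapsack_feasible_def)
  then have "(\<Sum>j\<in>D. w j) \<le> knapsack_opt (real B) (set N) w c"
    unfolding knapsack_opt_def using D by (intro Max_ge) (auto simp: knapsack_feasible_def)
  then have "ereal (1 / (1 + \<epsilon>)) * neg_log P
      \<le> ereal (1 / (1 + \<epsilon>)) * knapsack_opt (real B) (set N) w c"
    using D eps_nonneg by (intro ereal_mult_left_mono) (auto simp: sum_w P_def)
  also have "\<dots> \<le> neg_log Q"
    using cand_profit[of B] by (simp add: sum_w cand_subset Q_def)
  finally have QP: "Q \<le> P powr (1 / (1 + \<epsilon>))"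
    using eps_nonneg P Q by (intro le_powr_if_neg_log_ge) auto
  have "1 \<le> real B + \<beta> * P"
  proof (cases "D = {}")
    case True
    then show ?thesis using penalty_ge_1 by (simp add: P_def)
  next
    case False
    then obtain i where "i \<in> D" by blast
    then have "c i \<le> (\<Sum>j\<in>D. c j)"
      using D(1) \<open>finite D\<close> cost_nonneg by (intro member_le_sum) auto
    moreover have "1 \<le> c i" using \<open>i \<in> D\<close> D(1) cost_ge_1 by blast
    moreover have "0 \<le> \<beta> * P" using P penalty_ge_1 by simp
    ultimately show ?thesis using D(2) by linarith
  qed
  \<comment> \<open>On the left, \<open>real B\<close> bounds the access cost of the candidate from
    above; on the right it is exactly that of \<open>D\<close>.\<close>
  then have "real B + \<beta> * Q \<le> 2 * \<beta> powr (\<epsilon> / (1 + \<epsilon>)) * (real B + \<beta> * P)"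
    by (intro budget_powr_bound penalty_ge_1 P eps_nonneg QP) auto
  then show ?thesis
    using cand_budget[of B] D(2) by (simp add: dss_cost_def P_def Q_def)
qed

text \<open>Integral costs make the access cost of an optimal selection itself a budget, so trying
  only integers loses nothing.\<close>

lemma optimal_selection_cost_is_budget:
  obtains D B where "D \<subseteq> set N" "dss_cost c \<rho> \<beta> D = dss_opt (set N) c \<rho> \<beta>"
    "(\<Sum>j\<in>D. c j) = real B" "B \<le> m"
proof -
  have "dss_opt (set N) c \<rho> \<beta> \<in> dss_cost c \<rho> \<beta> ` Pow (set N)"
    unfolding dss_opt_def by (rule Min_in) auto
  then obtain D where D: "D \<subseteq> set N" "dss_cost c \<rho> \<beta> D = dss_opt (set N) c \<rho> \<beta>" by auto
  have "(\<Sum>j\<in>D. c j) \<in> \<int>" using D(1) cost_Ints by (intro Ints_sum) auto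
  moreover have "0 \<le> (\<Sum>j\<in>D. c j)" using D(1) cost_nonneg by (intro sum_nonneg) auto
  ultimately obtain B where B: "(\<Sum>j\<in>D. c j) = real B"
    by (metis Ints_cases of_int_0_le_iff of_int_of_nat_eq zero_le_imp_eq_int)
  have "0 \<le> (\<Prod>j\<in>D. \<rho> j)" using D(1) ratio_nonneg by (intro prod_nonneg) auto
  then have "(\<Sum>j\<in>D. c j) \<le> dss_cost c \<rho> \<beta> D" using penalty_ge_1 by (simp add: dss_cost_def)
  \<comment> \<open>The empty selection costs exactly \<beta>, which settles the \<beta> half of the
    minimum in \<open>budget_bound\<close>.\<close>
  also have "\<dots> \<le> dss_cost c \<rho> \<beta> {}"
    unfolding D(2) dss_opt_def by (rule Min_le) auto
  finally have "real B \<le> \<beta>" by (simp add: B dss_cost_def)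
  moreover have "real B \<le> (\<Sum>j\<in>set N. c j)"
    unfolding B[symmetric] using D(1) cost_nonneg by (intro sum_mono2) auto
  ultimately have "B \<le> m" by (simp add: m_def budget_bound_def le_nat_iff le_floor_iff)
  with D B that show thesis by blast
qed

text \<open>Before the loop, weights and total cost take \<open>length N\<close> steps each; the
  minimum and its floor take one each.\<close>

lemma ds_pp_unfold:
  "outcome (ds_pp A N c \<rho> \<beta>) = fst (outcome (best_timed A N c \<rho> \<beta> w m))"
  "steps (ds_pp A N c \<rho> \<beta>) = 2 * length N + 2 + steps (best_timed A N c \<rho> \<beta> w m)"
  by (simp_all add: ds_pp_def w_def m_def budget_bound_def outcome_sum_timed distinct_N)

lemma ds_pp_outcome:
  defines "D \<equiv> set (outcome (ds_pp A N c \<rho> \<beta>))"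
  shows "D \<subseteq> set N"
    and "dss_cost c \<rho> \<beta> D \<le> 2 * \<beta> powr (\<epsilon> / (1 + \<epsilon>)) * dss_opt (set N) c \<rho> \<beta>"
proof -
  have candidate: "snd (outcome (candidate_timed A N c \<rho> \<beta> w B)) = dss_cost c \<rho> \<beta> (set (cand B))" for B
    using distinct_cand[of B] by (simp add: cand_def snd_outcome_candidate_timed)
  obtain B where B: "outcome (best_timed A N c \<rho> \<beta> w m) = outcome (candidate_timed A N c \<rho> \<beta> w B)"
    using best_timed_is_candidate by blast
  then have D: "D = set (cand B)" by (simp add: D_def ds_pp_unfold cand_def)
  show "D \<subseteq> set N" unfolding D by (rule cand_subset)
  obtain D' B' where D': "D' \<subseteq> set N" "dss_cost c \<rho> \<beta> D' = dss_opt (set N) c \<rho> \<beta>"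
    "(\<Sum>j\<in>D'. c j) = real B'" "B' \<le> m"
    by (rule optimal_selection_cost_is_budget)
  have "dss_cost c \<rho> \<beta> D \<le> dss_cost c \<rho> \<beta> (set (cand B'))"
    using best_timed_minimal[OF D'(4), of A N c \<rho> \<beta> w] by (simp add: B candidate D)
  with cand_cost[OF D'(1,3)] show "dss_cost c \<rho> \<beta> D \<le> 2 * \<beta> powr (\<epsilon> / (1 + \<epsilon>)) * dss_opt (set N) c \<rho> \<beta>"
    by (simp add: D'(2))
qed

section \<open>Running time\<close>

lemma ds_pp_steps_le:
  assumes "\<And>B. B \<le> m \<Longrightarrow> knapsack_time A (real B) N w c \<le> T"
  shows "steps (ds_pp A N c \<rho> \<beta>) \<le> 2 * length N + 2 + (m + 1) * (T + 2 * length N + 4)"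
proof -
  \<comment> \<open>The summand \<open>2 * length N + 2\<close> pays for evaluating \<phi>; the two
    loop steps raise the 2 to the final 4.\<close>
  have "steps (candidate_timed A N c \<rho> \<beta> w B) \<le> T + 2 * length N + 2" if "B \<le> m" for B
    using assms[OF that] length_cand_le[of B] by (simp add: steps_candidate_timed cand_def)
  from steps_best_timed_le[of m A N c \<rho> \<beta> w, OF this] show ?thesis
    by (simp add: ds_pp_unfold algebra_simps)
qed

text \<open>The polynomial is the bound of \<open>ds_pp_steps_le\<close> with
  \<open>length N\<close> and \<open>m\<close> both replaced by the unary size \<open>s\<close>: its
  factors are \<open>2 * s + 2\<close>, \<open>s + 1\<close> and
  \<open>poly p s + 2 * s + 4\<close>.\<close>

lemma ds_pp_steps_le_unary:
  fixes p :: "nat poly"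
  assumes "\<And>B. knapsack_time A (real B) N w c \<le> poly p (knapsack_size (real B) N c)"
  shows "steps (ds_pp A N c \<rho> \<beta>)
    \<le> poly ([:2, 2:] + [:1, 1:] * (p + [:4, 2:])) (dss_unary_size N c \<beta>)"
proof -
  define s where "s = dss_unary_size N c \<beta>"
  have m\<beta>: "real m \<le> \<beta>" using m_le by (simp add: budget_bound_def)
  have m: "m \<le> s" using m\<beta> unfolding s_def dss_unary_size_def by linarith
  have n: "length N \<le> s" by (simp add: s_def dss_unary_size_def)
  have "knapsack_time A (real B) N w c \<le> poly p s" if "B \<le> m" for B
  proof -
    have "real B \<le> \<beta>" using that m\<beta> by linarith
    then show ?thesis
      unfolding s_def
      by (intro order_trans[OF assms] poly_nat_mono knapsack_size_le_dss_unary_size)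
  qed
  then have "steps (ds_pp A N c \<rho> \<beta>) \<le> 2 * length N + 2 + (m + 1) * (poly p s + 2 * length N + 4)"
    by (rule ds_pp_steps_le)
  also have "\<dots> \<le> 2 * s + 2 + (s + 1) * (poly p s + 2 * s + 4)"
    using m n by (intro add_mono mult_mono) auto
  also have "\<dots> = poly ([:2, 2:] + [:1, 1:] * (p + [:4, 2:])) s"
    by (simp add: algebra_simps)
  finally show ?thesis by (simp only: s_def)
qed

text \<open>A nonempty \<open>N\<close> makes both \<open>length N\<close> and \<open>M\<close> at
  least 1, so additive constants can be absorbed into the product.\<close>

lemma ds_pp_steps_le_budget_bound:
  assumes "N \<noteq> []" and F: "\<And>B. real (knapsack_time A (real B) N w c) \<le> F"
  shows "real (steps (ds_pp A N c \<rho> \<beta>)) \<le> 22 * F * budget_bound (set N) c \<beta>"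
proof -
  \<comment> \<open>\<open>ds_pp_steps_le\<close> needs a natural bound, so \<open>F\<close> is
    rounded down; this is safe since step counts are natural.\<close>
  define T M where "T = nat \<lfloor>F\<rfloor>" and "M = budget_bound (set N) c \<beta>"
  have time: "knapsack_time A (real B) N w c \<le> T" for B
    using F[of B] by (simp add: T_def le_nat_iff le_floor_iff)
  have nT: "length N \<le> T" using length_le_knapsack_time time order_trans by blast
  have n: "1 \<le> length N" using \<open>N \<noteq> []\<close> by (simp add: Suc_le_eq)
  have TF: "real T \<le> F" using F[of 0] unfolding T_def by (intro of_nat_floor) linarith
  obtain i where i: "i \<in> set N" using \<open>N \<noteq> []\<close> by (cases N) auto
  have "c i \<le> (\<Sum>j\<in>set N. c j)"
    using i cost_nonneg by (intro member_le_sum) auto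
  then have M: "1 \<le> M" using penalty_ge_1 cost_ge_1[OF i] by (simp add: M_def budget_bound_def)
  have "steps (ds_pp A N c \<rho> \<beta>) \<le> 2 * length N + 2 + (m + 1) * (T + 2 * length N + 4)"
    by (rule ds_pp_steps_le) (rule time)
  \<comment> \<open>By \<open>1 \<le> length N \<le> T\<close>, each constant and each
    \<open>length N\<close> is replaced by a multiple of \<open>T\<close>.\<close>
  also have "\<dots> \<le> 4 * T + (m + 1) * (7 * T)"
    using n nT by (intro add_mono mult_mono) auto
  also have "\<dots> \<le> (m + 1) * (11 * T)" by (simp add: algebra_simps)
  finally have "real (steps (ds_pp A N c \<rho> \<beta>)) \<le> real ((m + 1) * (11 * T))"
    by (rule of_nat_mono)
  also have "\<dots> = (real m + 1) * (11 * real T)" by (simp add: algebra_simps)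
  \<comment> \<open>Here \<open>m \<le> M\<close> and \<open>1 \<le> M\<close> give
    \<open>m + 1 \<le> 2 * M\<close>.\<close>
  also have "\<dots> \<le> (2 * M) * (11 * F)"
    using m_le M TF by (intro mult_mono) (auto simp: M_def)
  finally show ?thesis by (simp add: M_def mult_ac)
qed

end

text \<open>\<open>C\<close> is chosen before everything except \<delta>. The family
  \<open>A\<close> over \<open>E\<close> expresses that the O-constants are uniform in \<epsilon>.
  Requiring \<open>1 \<le> n\<^sub>0\<close> excludes the empty instance, where
  \<open>budget_bound\<close> is 0 but steps are still spent.\<close>

theorem theorem18:
  fixes \<delta> :: real
  assumes "\<delta> < 1"
  shows "\<exists>C :: real.
    \<forall>(E :: real set) (A :: real \<Rightarrow> 'a knapsack_algorithm) (f :: nat \<Rightarrow> real \<Rightarrow> real) (n\<^sub>0 :: nat).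
      1 \<le> n\<^sub>0 \<and>
      (\<forall>\<epsilon>\<in>E. 0 \<le> \<epsilon> \<and> knapsack_approximation \<epsilon> (A \<epsilon>) \<and> knapsack_polynomial_time (A \<epsilon>)) \<and>
      (\<exists>K>0. \<forall>\<epsilon>\<in>E. \<forall>B U \<pi> \<gamma>. knapsack_instance B U \<pi> \<gamma> \<and> n\<^sub>0 \<le> length U \<longrightarrow>
         real (knapsack_time (A \<epsilon>) B U \<pi> \<gamma>) \<le> K * f (length U) \<epsilon>)
      \<longrightarrow>
      (\<forall>\<epsilon>\<in>E. dss_pseudo_polynomial_on (dss_bounded_integral_instance \<delta>) (ds_pp (A \<epsilon>))) \<and>
      (\<forall>\<epsilon>\<in>E. \<forall>N c \<rho> \<beta>. dss_bounded_integral_instance \<delta> N c \<rho> \<beta> \<longrightarrow>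
         (let D = set (outcome (ds_pp (A \<epsilon>) N c \<rho> \<beta>)) in
            D \<subseteq> set N \<and>
            dss_cost c \<rho> \<beta> D \<le> C * \<beta> powr (\<epsilon> / (1 + \<epsilon>)) * dss_opt (set N) c \<rho> \<beta>)) \<and>
      (\<exists>K>0. \<forall>\<epsilon>\<in>E. \<forall>N c \<rho> \<beta>.
         dss_bounded_integral_instance \<delta> N c \<rho> \<beta> \<and> n\<^sub>0 \<le> length N \<longrightarrow>
         real (steps (ds_pp (A \<epsilon>) N c \<rho> \<beta>)) \<le> K * (f (length N) \<epsilon> * budget_bound (set N) c \<beta>))"
proof (intro exI[of _ 2] allI impI, elim conjE exE)
  fix E :: "real set" and A :: "real \<Rightarrow> 'a knapsack_algorithm" and f :: "nat \<Rightarrow> real \<Rightarrow> real"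
    and n\<^sub>0 :: nat and K :: real
  assume n\<^sub>0: "1 \<le> n\<^sub>0"
    and A: "\<forall>\<epsilon>\<in>E. 0 \<le> \<epsilon> \<and> knapsack_approximation \<epsilon> (A \<epsilon>) \<and> knapsack_polynomial_time (A \<epsilon>)"
    and K: "0 < K"
    and f: "\<forall>\<epsilon>\<in>E. \<forall>B U \<pi> \<gamma>. knapsack_instance B U \<pi> \<gamma> \<and> n\<^sub>0 \<le> length U \<longrightarrow>
         real (knapsack_time (A \<epsilon>) B U \<pi> \<gamma>) \<le> K * f (length U) \<epsilon>"
  have run: "dss_run (A \<epsilon>) N c \<rho> \<beta> \<delta> \<epsilon>"
    if "\<epsilon> \<in> E" "dss_bounded_integral_instance \<delta> N c \<rho> \<beta>" for \<epsilon> N c \<rho> \<beta>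
    using A that by unfold_locales auto
  have "dss_pseudo_polynomial_on (dss_bounded_integral_instance \<delta>) (ds_pp (A \<epsilon>))" if "\<epsilon> \<in> E" for \<epsilon>
  proof -
    obtain p where p: "\<And>B U \<pi> \<gamma>. knapsack_instance B U \<pi> \<gamma> \<Longrightarrow>
        knapsack_time (A \<epsilon>) B U \<pi> \<gamma> \<le> poly p (knapsack_size B U \<gamma>)"
      using A \<open>\<epsilon> \<in> E\<close> unfolding knapsack_polynomial_time_def by blast
    have "steps (ds_pp (A \<epsilon>) N c \<rho> \<beta>)
        \<le> poly ([:2, 2:] + [:1, 1:] * (p + [:4, 2:])) (dss_unary_size N c \<beta>)"
      if "dss_bounded_integral_instance \<delta> N c \<rho> \<beta>" for N c \<rho> \<beta>
    proof -
      interpret dss_run "A \<epsilon>" N c \<rho> \<beta> \<delta> \<epsilon> by (rule run) fact+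
      show ?thesis using p[OF knapsack_instance] by (rule ds_pp_steps_le_unary)
    qed
    then show ?thesis unfolding dss_pseudo_polynomial_on_def by blast
  qed
  moreover have "let D = set (outcome (ds_pp (A \<epsilon>) N c \<rho> \<beta>)) in D \<subseteq> set N \<and>
      dss_cost c \<rho> \<beta> D \<le> 2 * \<beta> powr (\<epsilon> / (1 + \<epsilon>)) * dss_opt (set N) c \<rho> \<beta>"
    if "\<epsilon> \<in> E" "dss_bounded_integral_instance \<delta> N c \<rho> \<beta>" for \<epsilon> N c \<rho> \<beta>
    unfolding Let_def using dss_run.ds_pp_outcome[OF run[OF that]] by blast
  \<comment> \<open>The constant is 22 from \<open>ds_pp_steps_le_budget_bound\<close>, taken with
    \<open>F = K * f (length N) \<epsilon>\<close>.\<close>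
  moreover have "real (steps (ds_pp (A \<epsilon>) N c \<rho> \<beta>))
      \<le> 22 * K * (f (length N) \<epsilon> * budget_bound (set N) c \<beta>)"
    if "\<epsilon> \<in> E" "dss_bounded_integral_instance \<delta> N c \<rho> \<beta>" "n\<^sub>0 \<le> length N" for \<epsilon> N c \<rho> \<beta>
  proof -
    interpret dss_run "A \<epsilon>" N c \<rho> \<beta> \<delta> \<epsilon> by (rule run) fact+
    have "N \<noteq> []" using n\<^sub>0 that(3) by auto
    moreover have "real (knapsack_time (A \<epsilon>) (real B) N w c) \<le> K * f (length N) \<epsilon>" for B
      using f knapsack_instance that by blast
    ultimately show ?thesis
      using ds_pp_steps_le_budget_bound[of "K * f (length N) \<epsilon>"] by (simp add: mult_ac)
  qed
  moreover have "0 < 22 * K" using K by simp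
  ultimately show "(\<forall>\<epsilon>\<in>E. dss_pseudo_polynomial_on (dss_bounded_integral_instance \<delta>) (ds_pp (A \<epsilon>))) \<and>
      (\<forall>\<epsilon>\<in>E. \<forall>N c \<rho> \<beta>. dss_bounded_integral_instance \<delta> N c \<rho> \<beta> \<longrightarrow>
         (let D = set (outcome (ds_pp (A \<epsilon>) N c \<rho> \<beta>)) in
            D \<subseteq> set N \<and>
            dss_cost c \<rho> \<beta> D \<le> 2 * \<beta> powr (\<epsilon> / (1 + \<epsilon>)) * dss_opt (set N) c \<rho> \<beta>)) \<and>
      (\<exists>K>0. \<forall>\<epsilon>\<in>E. \<forall>N c \<rho> \<beta>.
         dss_bounded_integral_instance \<delta> N c \<rho> \<beta> \<and> n\<^sub>0 \<le> length N \<longrightarrow>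
         real (steps (ds_pp (A \<epsilon>) N c \<rho> \<beta>)) \<le> K * (f (length N) \<epsilon> * budget_bound (set N) c \<beta>))"
    by blast
qed

end
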